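(* Let $A$ be an MV-algebra and let $I\ne\{0\}$ be a proper ideal of $A$. Then $\mathrm{diam}(\Gamma_I(A))=2$ if and only if $\mathrm{diam}(\Gamma(A/I))=1$ or $\mathrm{diam}(\Gamma(A/I))=2$.
   Context: An MV-algebra is an algebra $(A,\oplus,*,0)$ of type $(2,1,0)$ such that $(A,\oplus,0)$ is a commutative monoid, $x^{**}=x$, $x\oplus 0^*=0^*$, and $(x^*\oplus y)^*\oplus y=(y^*\oplus x)^*\oplus x$ for all $x,y$. Put $1=0^*$, $x\odot y=(x^*\oplus y^* )^*$, and $x\le y$ iff $x^*\oplus y=1$ (a partial order). An ideal of $A$ is a subset $I\subseteq A$ with $0\in I$; $a,b\in I$ implies $a\oplus b\in I$; and $b\in I$, $a\le b$ implies $a\in I$. It is proper if $I\ne A$. With $d(x,y)=(x\odot y^* )\oplus(y\odot x^* )$, the relation $x\equiv_I y\iff d(x,y)\in I$ is a congruence and $A/I$ is the corresponding quotient MV-algebra. For a proper ideal $I$, $\Gamma_I(A)$ is the simple graph with vertex set $\{x\in A\setminus I : \exists y\in A\setminus I,\ x\odot y\in I\}$, in which distinct vertices $x,y$ are adjacent iff $x\odot y\in I$. For a nontrivial MV-algebra $B$ (at least two elements), the zero-divisor graph is $\Gamma(B)=\Gamma_{\{0\}}(B)$. The diameter of a graph is the supremum (in $[0,\infty]$) of the distances (lengths of shortest paths) between pairs of vertices. *)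

theory Defs
  imports
    "HOL-Library.Extended_Nat"
    "Graph_Theory.Pair_Digraph"
    "HOL-Algebra.Group"
begin

section \<open>MV-algebras\<close>

record 'a mv_algebra = "'a partial_object" +
  mv_add :: "'a \<Rightarrow> 'a \<Rightarrow> 'a" (infixl \<open>\<oplus>\<index>\<close> 65)
  mv_neg :: "'a \<Rightarrow> 'a" (\<open>\<sim>\<index> _\<close> [81] 80)
  mv_zero :: "'a" (\<open>\<zero>\<index>\<close>)

locale mv_algebra =
  fixes A (structure)
  assumes add_comm_monoid:
      "comm_monoid \<lparr>carrier = carrier A, mult = mv_add A, one = mv_zero A\<rparr>"
    and neg_closed: "x \<in> carrier A \<Longrightarrow> \<sim> x \<in> carrier A"
    and neg_neg: "x \<in> carrier A \<Longrightarrow> \<sim> (\<sim> x) = x"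
    and add_neg_zero: "x \<in> carrier A \<Longrightarrow> x \<oplus> \<sim> \<zero> = \<sim> \<zero>"
    and lukasiewicz: "\<lbrakk>x \<in> carrier A; y \<in> carrier A\<rbrakk> \<Longrightarrow>
      \<sim> (\<sim> x \<oplus> y) \<oplus> y = \<sim> (\<sim> y \<oplus> x) \<oplus> x"

definition mv_one :: "('a, 'm) mv_algebra_scheme \<Rightarrow> 'a" (\<open>\<one>\<^sub>M\<index>\<close>)
  where "\<one>\<^sub>M\<^bsub>A\<^esub> = \<sim>\<^bsub>A\<^esub> \<zero>\<^bsub>A\<^esub>"

definition mv_mult :: "('a, 'm) mv_algebra_scheme \<Rightarrow> 'a \<Rightarrow> 'a \<Rightarrow> 'a" (infixl \<open>\<odot>\<index>\<close> 70)
  where "x \<odot>\<^bsub>A\<^esub> y = \<sim>\<^bsub>A\<^esub> (\<sim>\<^bsub>A\<^esub> x \<oplus>\<^bsub>A\<^esub> \<sim>\<^bsub>A\<^esub> y)"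

definition mv_le :: "('a, 'm) mv_algebra_scheme \<Rightarrow> 'a \<Rightarrow> 'a \<Rightarrow> bool" (infix \<open>\<preceq>\<index>\<close> 50)
  where "x \<preceq>\<^bsub>A\<^esub> y \<longleftrightarrow> \<sim>\<^bsub>A\<^esub> x \<oplus>\<^bsub>A\<^esub> y = \<one>\<^sub>M\<^bsub>A\<^esub>"

definition mv_dist :: "('a, 'm) mv_algebra_scheme \<Rightarrow> 'a \<Rightarrow> 'a \<Rightarrow> 'a"
  where "mv_dist A x y = (x \<odot>\<^bsub>A\<^esub> \<sim>\<^bsub>A\<^esub> y) \<oplus>\<^bsub>A\<^esub> (y \<odot>\<^bsub>A\<^esub> \<sim>\<^bsub>A\<^esub> x)"

definition mv_ideal :: "('a, 'm) mv_algebra_scheme \<Rightarrow> 'a set \<Rightarrow> bool"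
  where "mv_ideal A I \<longleftrightarrow> I \<subseteq> carrier A \<and> \<zero>\<^bsub>A\<^esub> \<in> I
    \<and> (\<forall>a\<in>I. \<forall>b\<in>I. a \<oplus>\<^bsub>A\<^esub> b \<in> I)
    \<and> (\<forall>b\<in>I. \<forall>a\<in>carrier A. a \<preceq>\<^bsub>A\<^esub> b \<longrightarrow> a \<in> I)"

definition mv_proper_ideal :: "('a, 'm) mv_algebra_scheme \<Rightarrow> 'a set \<Rightarrow> bool"
  where "mv_proper_ideal A I \<longleftrightarrow> mv_ideal A I \<and> I \<noteq> carrier A"

definition mv_cong :: "('a, 'm) mv_algebra_scheme \<Rightarrow> 'a set \<Rightarrow> 'a rel"
  where "mv_cong A I = {(x, y). x \<in> carrier A \<and> y \<in> carrier A \<and> mv_dist A x y \<in> I}"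

text \<open>The unions below range over representatives. For an ideal \<open>I\<close>, \<open>mv_cong A I\<close> is
  a congruence, so all members of each union coincide and the result is a single class.\<close>

definition mv_quotient :: "('a, 'm) mv_algebra_scheme \<Rightarrow> 'a set \<Rightarrow> 'a set mv_algebra"
  where "mv_quotient A I =
    \<lparr>carrier = carrier A // mv_cong A I,
     mv_add = \<lambda>X Y. \<Union>x\<in>X. \<Union>y\<in>Y. mv_cong A I `` {x \<oplus>\<^bsub>A\<^esub> y},
     mv_neg = \<lambda>X. \<Union>x\<in>X. mv_cong A I `` {\<sim>\<^bsub>A\<^esub> x},
     mv_zero = mv_cong A I `` {\<zero>\<^bsub>A\<^esub>}\<rparr>"

section \<open>Graphs\<close>

text \<open>A simple graph is represented as a digraph containing both arcs \<open>(x, y)\<close> and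
  \<open>(y, x)\<close> for each edge; \<open>\<odot>\<close> is commutative, so the arc set below is symmetric.\<close>

definition ideal_graph :: "('a, 'm) mv_algebra_scheme \<Rightarrow> 'a set \<Rightarrow> 'a pair_pre_digraph"
  where "ideal_graph A I =
    (let V = {x \<in> carrier A - I. \<exists>y \<in> carrier A - I. x \<odot>\<^bsub>A\<^esub> y \<in> I}
     in \<lparr>pverts = V, parcs = {(x, y). x \<in> V \<and> y \<in> V \<and> x \<noteq> y \<and> x \<odot>\<^bsub>A\<^esub> y \<in> I}\<rparr>)"

definition zero_divisor_graph :: "('a, 'm) mv_algebra_scheme \<Rightarrow> 'a pair_pre_digraph"
  where "zero_divisor_graph B = ideal_graph B {\<zero>\<^bsub>B\<^esub>}"

text \<open>In \<open>enat\<close> an empty infimum is \<open>\<infinity>\<close> and an empty supremum is \<open>0\<close>: disconnected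
  vertices are at distance \<open>\<infinity>\<close>, and the graph without vertices has diameter \<open>0\<close>.\<close>

definition graph_dist :: "('a, 'b) pre_digraph \<Rightarrow> 'a \<Rightarrow> 'a \<Rightarrow> enat"
  where "graph_dist G u v = (INF p \<in> {p. pre_digraph.apath G u p v}. enat (length p))"

definition graph_diam :: "('a, 'b) pre_digraph \<Rightarrow> enat"
  where "graph_diam G = (SUP u \<in> verts G. SUP v \<in> verts G. graph_dist G u v)"

end

theory Submission
  imports Defs
begin

text \<open>
  For a proper ideal \<open>I\<close>, the vertices of \<open>\<Gamma>\<^sub>I(A)\<close> are the \<open>x\<close> with \<open>x \<notin> I\<close> and \<open>x\<^sup>* \<notin> I\<close>, and
  adjacency depends only on the classes modulo \<open>I\<close>. Both graphs are therefore described by the same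
  relation \<open>x \<odot> y \<in> I\<close>, and their distances agree on incongruent vertices; congruent vertices are at
  distance at most \<open>2\<close> in \<open>\<Gamma>\<^sub>I(A)\<close>, through \<open>x\<^sup>*\<close>. So the two diameters are at most \<open>2\<close> simultaneously.
  Moreover \<open>diam(\<Gamma>\<^sub>I(A)) \<le> 1\<close> iff \<open>diam(\<Gamma>(A/I)) \<le> 0\<close>: since \<open>I \<noteq> {0}\<close>, every class has at least two
  elements, so completeness of \<open>\<Gamma>\<^sub>I(A)\<close> forces \<open>x \<odot> y \<in> I\<close> for all vertices \<open>x\<close>, \<open>y\<close>, equal or not;
  applied to \<open>x, y\<^sup>*\<close> and to \<open>y, x\<^sup>*\<close> this says \<open>x \<equiv> y\<close>.
\<close>

section \<open>Small distances in graphs\<close>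

text \<open>If every \<open>f p\<close> exceeds \<open>n\<close>, then \<open>Suc n\<close> is a
  lower bound. An empty \<open>S\<close> has infimum \<infinity> and no witness, so disconnected
  vertices need no separate case.\<close>

lemma Inf_enat_le_iff:
  fixes f :: "'a \<Rightarrow> nat"
  shows "(INF p \<in> S. enat (f p)) \<le> enat n \<longleftrightarrow> (\<exists>p\<in>S. f p \<le> n)"
proof
  assume le: "(INF p \<in> S. enat (f p)) \<le> enat n"
  show "\<exists>p\<in>S. f p \<le> n"
  proof (rule ccontr)
    assume "\<not> ?thesis"
    then have "enat (Suc n) \<le> (INF p \<in> S. enat (f p))"
      by (intro INF_greatest) (auto simp: not_le Suc_le_eq)
    from order_trans[OF this le] show False by simp
  qed
next
  assume "\<exists>p\<in>S. f p \<le> n"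
  then show "(INF p \<in> S. enat (f p)) \<le> enat n" by (meson INF_lower2 enat_ord_simps(1))
qed

lemma graph_dist_le_iff:
  "graph_dist G u v \<le> enat n \<longleftrightarrow> (\<exists>p. pre_digraph.apath G u p v \<and> length p \<le> n)"
  unfolding graph_dist_def Inf_enat_le_iff by simp

lemma graph_diam_le_iff:
  "graph_diam G \<le> d \<longleftrightarrow> (\<forall>u\<in>verts G. \<forall>v\<in>verts G. graph_dist G u v \<le> d)"
  unfolding graph_diam_def by (simp add: SUP_le_iff)

lemma length_le_1_iff: "length p \<le> 1 \<longleftrightarrow> p = [] \<or> (\<exists>e. p = [e])"
  by (cases p) auto

lemma length_le_2_iff: "length p \<le> 2 \<longleftrightarrow> p = [] \<or> (\<exists>e. p = [e]) \<or> (\<exists>e f. p = [e, f])"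
  by (cases p; cases "tl p") auto

context pair_wf_digraph
begin

lemma apath_single_iff: "apath u [e] v \<longleftrightarrow> e = (u, v) \<and> (u, v) \<in> parcs G \<and> u \<noteq> v"
  by (cases e) (auto simp: apath_Cons_iff apath_Nil_iff dest: in_arcsD2)

lemma apath_pair_iff:
  "apath u [e, f] v \<longleftrightarrow> (\<exists>w. e = (u, w) \<and> f = (w, v) \<and> (u, w) \<in> parcs G \<and> (w, v) \<in> parcs G \<and>
    u \<noteq> w \<and> w \<noteq> v \<and> u \<noteq> v)"
  by (cases e; cases f) (auto simp: apath_Cons_iff apath_Nil_iff dest: in_arcsD2)

text \<open>Only the empty path has length 0, and it is a path at \<open>u\<close> only when
  \<open>u\<close> is a vertex; hence the assumption.\<close>

lemma graph_dist_le_0_iff: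
  assumes "u \<in> pverts G"
  shows "graph_dist (with_proj G) u v \<le> 0 \<longleftrightarrow> u = v"
  using assms graph_dist_le_iff[of "with_proj G" u v 0]
  by (auto simp: zero_enat_def apath_def awalk_def)

lemma graph_dist_le_1_iff:
  assumes "u \<in> pverts G"
  shows "graph_dist (with_proj G) u v \<le> 1 \<longleftrightarrow> u = v \<or> (u, v) \<in> parcs G"
proof -
  have "graph_dist (with_proj G) u v \<le> 1 \<longleftrightarrow> apath u [] v \<or> (\<exists>e. apath u [e] v)"
    unfolding one_enat_def graph_dist_le_iff length_le_1_iff by blast
  then show ?thesis
    unfolding apath_single_iff using assms by (auto simp: apath_Nil_iff)
qed

lemma graph_dist_le_2_iff:
  assumes "u \<in> pverts G"
  shows "graph_dist (with_proj G) u v \<le> 2 \<longleftrightarrow>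
    u = v \<or> (u, v) \<in> parcs G \<or> (\<exists>w. (u, w) \<in> parcs G \<and> (w, v) \<in> parcs G)"
proof -
  have "graph_dist (with_proj G) u v \<le> 2 \<longleftrightarrow>
      apath u [] v \<or> (\<exists>e. apath u [e] v) \<or> (\<exists>e f. apath u [e, f] v)"
    unfolding numeral_eq_enat graph_dist_le_iff by (subst length_le_2_iff) blast
  then show ?thesis
    unfolding apath_single_iff apath_pair_iff using assms by (auto simp: apath_Nil_iff)
qed

end

section \<open>MV-algebras and ideals\<close>

context mv_algebra
begin

lemma add_closed: "\<lbrakk>x \<in> carrier A; y \<in> carrier A\<rbrakk> \<Longrightarrow> x \<oplus> y \<in> carrier A"
  and zero_closed: "\<zero> \<in> carrier A"
  and add_assoc: "\<lbrakk>x \<in> carrier A; y \<in> carrier A; z \<in> carrier A\<rbrakk> \<Longrightarrow> x \<oplus> y \<oplus> z = x \<oplus> (y \<oplus> z)"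
  and add_comm: "\<lbrakk>x \<in> carrier A; y \<in> carrier A\<rbrakk> \<Longrightarrow> x \<oplus> y = y \<oplus> x"
  and add_zero: "x \<in> carrier A \<Longrightarrow> x \<oplus> \<zero> = x"
  and zero_add: "x \<in> carrier A \<Longrightarrow> \<zero> \<oplus> x = x"
proof -
  interpret M: comm_monoid "\<lparr>carrier = carrier A, mult = mv_add A, one = mv_zero A\<rparr>"
    by (rule add_comm_monoid)
  show "\<lbrakk>x \<in> carrier A; y \<in> carrier A\<rbrakk> \<Longrightarrow> x \<oplus> y \<in> carrier A"
    and "\<zero> \<in> carrier A"
    and "\<lbrakk>x \<in> carrier A; y \<in> carrier A; z \<in> carrier A\<rbrakk> \<Longrightarrow> x \<oplus> y \<oplus> z = x \<oplus> (y \<oplus> z)"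
    and "\<lbrakk>x \<in> carrier A; y \<in> carrier A\<rbrakk> \<Longrightarrow> x \<oplus> y = y \<oplus> x"
    and "x \<in> carrier A \<Longrightarrow> x \<oplus> \<zero> = x"
    and "x \<in> carrier A \<Longrightarrow> \<zero> \<oplus> x = x"
    using M.m_closed M.one_closed M.m_assoc M.m_comm M.r_one M.l_one by simp_all
qed

lemma add_left_comm:
  "\<lbrakk>x \<in> carrier A; y \<in> carrier A; z \<in> carrier A\<rbrakk> \<Longrightarrow> x \<oplus> (y \<oplus> z) = y \<oplus> (x \<oplus> z)"
  by (metis add_assoc add_comm)

lemmas add_ac = add_assoc add_comm add_left_comm

lemma one_closed: "\<one>\<^sub>M \<in> carrier A"
  by (simp add: mv_one_def neg_closed zero_closed)

lemma mult_closed: "\<lbrakk>x \<in> carrier A; y \<in> carrier A\<rbrakk> \<Longrightarrow> x \<odot> y \<in> carrier A"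
  by (simp add: mv_mult_def neg_closed add_closed)

lemmas closed = add_closed zero_closed one_closed neg_closed mult_closed

lemma mult_comm: "\<lbrakk>x \<in> carrier A; y \<in> carrier A\<rbrakk> \<Longrightarrow> x \<odot> y = y \<odot> x"
  by (simp add: mv_mult_def add_comm neg_closed)

lemma neg_mult: "\<lbrakk>x \<in> carrier A; y \<in> carrier A\<rbrakk> \<Longrightarrow> \<sim> (x \<odot> y) = \<sim> x \<oplus> \<sim> y"
  by (simp add: mv_mult_def closed neg_neg)

lemma add_eq_neg_mult: "\<lbrakk>x \<in> carrier A; y \<in> carrier A\<rbrakk> \<Longrightarrow> x \<oplus> y = \<sim> (\<sim> x \<odot> \<sim> y)"
  by (simp add: mv_mult_def closed neg_neg)

lemma neg_one: "\<sim> \<one>\<^sub>M = \<zero>"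
  by (simp add: mv_one_def neg_neg zero_closed)

lemma add_one: "x \<in> carrier A \<Longrightarrow> x \<oplus> \<one>\<^sub>M = \<one>\<^sub>M"
  by (simp add: mv_one_def add_neg_zero)

lemma one_add: "x \<in> carrier A \<Longrightarrow> \<one>\<^sub>M \<oplus> x = \<one>\<^sub>M"
  by (simp add: add_one add_comm one_closed)

lemma mult_one: "x \<in> carrier A \<Longrightarrow> x \<odot> \<one>\<^sub>M = x"
  by (simp add: mv_mult_def neg_one closed neg_neg add_zero)

text \<open>For \<open>y = 1\<close> the left side of the axiom \<open>lukasiewicz\<close> collapses
  to 1 and the right side to \<open>\<sim> x \<oplus> x\<close>.\<close>

lemma neg_add_self: "x \<in> carrier A \<Longrightarrow> \<sim> x \<oplus> x = \<one>\<^sub>M"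
  using lukasiewicz[of x "\<one>\<^sub>M"]
  by (simp add: add_one neg_one zero_add closed)

lemma add_neg_self: "x \<in> carrier A \<Longrightarrow> x \<oplus> \<sim> x = \<one>\<^sub>M"
  using neg_add_self[of x] add_comm[of x "\<sim> x"] by (simp add: closed)

lemma mult_neg_self: "x \<in> carrier A \<Longrightarrow> x \<odot> \<sim> x = \<zero>"
  by (simp add: mv_mult_def neg_neg closed neg_add_self neg_one)

text \<open>Both sides are the lattice join of \<open>x\<close> and \<open>y\<close>: this is the
  axiom \<open>lukasiewicz\<close> written with \<open>\<odot>\<close>.\<close>

lemma join_comm:
  "\<lbrakk>x \<in> carrier A; y \<in> carrier A\<rbrakk> \<Longrightarrow> y \<oplus> (x \<odot> \<sim> y) = x \<oplus> (y \<odot> \<sim> x)"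
  using lukasiewicz[of x y] by (simp add: mv_mult_def neg_neg closed add_comm)

text \<open>Commuting the joins of \<open>x\<^sup>*, y\<^sup>*\<close> and of \<open>y, z\<^sup>*\<close> exposes a summand \<open>y\<^sup>* \<oplus> y = 1\<close>.\<close>

lemma add_cut_eq_one:
  assumes "x \<in> carrier A" "y \<in> carrier A" "z \<in> carrier A"
  shows "(\<sim> x \<oplus> \<sim> z) \<oplus> ((x \<odot> \<sim> y) \<oplus> (y \<odot> z)) = \<one>\<^sub>M"
proof -
  have "\<sim> x \<oplus> (x \<odot> \<sim> y) = \<sim> y \<oplus> (y \<odot> \<sim> x)"
    using join_comm[of "\<sim> y" "\<sim> x"] assms by (simp add: closed neg_neg mult_comm)
  moreover have "\<sim> z \<oplus> (y \<odot> z) = y \<oplus> (\<sim> z \<odot> \<sim> y)"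
    using join_comm[of y "\<sim> z"] assms by (simp add: closed neg_neg)
  moreover have "(\<sim> x \<oplus> \<sim> z) \<oplus> ((x \<odot> \<sim> y) \<oplus> (y \<odot> z))
      = (\<sim> x \<oplus> (x \<odot> \<sim> y)) \<oplus> (\<sim> z \<oplus> (y \<odot> z))"
    using assms by (simp add: add_ac closed)
  ultimately have "(\<sim> x \<oplus> \<sim> z) \<oplus> ((x \<odot> \<sim> y) \<oplus> (y \<odot> z))
      = (\<sim> y \<oplus> (y \<odot> \<sim> x)) \<oplus> (y \<oplus> (\<sim> z \<odot> \<sim> y))" by simp
  also have "\<dots> = (\<sim> y \<oplus> y) \<oplus> ((y \<odot> \<sim> x) \<oplus> (\<sim> z \<odot> \<sim> y))"
    using assms by (simp add: add_ac closed)
  finally show ?thesis using assms by (simp add: neg_add_self one_add closed)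
qed

text \<open>With \<open>x \<odot> \<sim> y\<close> read as truncated difference and \<open>z\<close>
  replaced by its negation, this is the triangle inequality.\<close>

lemma le_cut:
  "\<lbrakk>x \<in> carrier A; y \<in> carrier A; z \<in> carrier A\<rbrakk> \<Longrightarrow> x \<odot> z \<preceq> (x \<odot> \<sim> y) \<oplus> (y \<odot> z)"
  by (simp add: mv_le_def neg_mult add_cut_eq_one)

text \<open>Multiplying by \<open>w\<close> does not increase a truncated difference, which makes
  the congruence compatible with \<open>\<odot>\<close>. Once the negation is expanded, the claim is
  a regrouping of \<open>add_cut_eq_one\<close>.\<close>

lemma mult_left_le_diff:
  assumes "x \<in> carrier A" "y \<in> carrier A" "w \<in> carrier A"
  shows "(x \<odot> w) \<odot> \<sim> (y \<odot> w) \<preceq> x \<odot> \<sim> y"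
proof -
  have "\<sim> ((x \<odot> w) \<odot> \<sim> (y \<odot> w)) = (\<sim> x \<oplus> \<sim> w) \<oplus> (y \<odot> w)"
    using neg_mult[of "x \<odot> w" "\<sim> (y \<odot> w)"] neg_mult[of x w] neg_neg[of "y \<odot> w"] assms
    by (simp add: closed)
  then show ?thesis
    using add_cut_eq_one[of x y w] assms by (simp add: mv_le_def add_ac closed)
qed

lemma le_add: "\<lbrakk>x \<in> carrier A; y \<in> carrier A\<rbrakk> \<Longrightarrow> x \<preceq> x \<oplus> y"
  by (simp add: mv_le_def add_assoc[symmetric] closed neg_add_self one_add)

lemma le_antisym:
  assumes "x \<in> carrier A" "y \<in> carrier A" "x \<preceq> y" "y \<preceq> x"
  shows "x = y"
  using lukasiewicz[of x y] assms by (simp add: mv_le_def neg_one zero_add)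

text \<open>Absorption of \<open>a\<close> by \<open>y\<close> makes the join of
  \<open>\<sim> a\<close> and \<open>y\<close> equal to \<open>y \<oplus> \<sim> y = 1\<close>.
  Hence \<open>a \<preceq> y \<odot> a \<preceq> a\<close>, and negating
  \<open>y \<odot> a = a\<close> gives the claim.\<close>

lemma neg_add_absorb:
  assumes y: "y \<in> carrier A" and a: "a \<in> carrier A" and eq: "y \<oplus> a = y"
  shows "\<sim> a \<oplus> \<sim> y = \<sim> a"
proof -
  have "\<sim> a \<odot> \<sim> y = \<sim> y"
    using eq y a by (simp add: mv_mult_def neg_neg add_comm)
  then have "\<sim> a \<oplus> (y \<odot> a) = \<one>\<^sub>M"
    using join_comm[of "\<sim> a" y] y a by (simp add: neg_neg closed add_neg_self)
  then have "a \<preceq> y \<odot> a" by (simp add: mv_le_def)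
  moreover have "y \<odot> a \<preceq> a"
    using y a by (simp add: mv_le_def neg_mult add_assoc closed neg_add_self add_one)
  ultimately have "y \<odot> a = a" using y a by (intro le_antisym closed)
  then show ?thesis using neg_mult[of y a] y a by (simp add: add_comm closed)
qed

text \<open>If both operations fixed \<open>x\<close>, then \<open>x\<close> and
  \<open>\<sim> x\<close> would both absorb \<open>a\<close>. By \<open>neg_add_absorb\<close>,
  \<open>\<sim> a\<close> would absorb both of them, hence also their sum 1, forcing
  \<open>a = 0\<close>.\<close>

lemma add_or_diff_moves:
  assumes x: "x \<in> carrier A" and a: "a \<in> carrier A" "a \<noteq> \<zero>"
  shows "x \<oplus> a \<noteq> x \<or> x \<odot> \<sim> a \<noteq> x"
proof (rule ccontr)
  assume "\<not> ?thesis"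
  then have add: "x \<oplus> a = x" and diff: "x \<odot> \<sim> a = x" by auto
  have "\<sim> x \<oplus> a = \<sim> x"
    using neg_mult[of x "\<sim> a"] diff x a by (simp add: neg_neg closed)
  then have "\<sim> a \<oplus> x = \<sim> a"
    using neg_add_absorb[of "\<sim> x" a] x a by (simp add: neg_neg closed)
  moreover have "\<sim> a \<oplus> \<sim> x = \<sim> a"
    by (rule neg_add_absorb[OF x a(1) add])
  ultimately have "\<sim> a = \<sim> a \<oplus> (x \<oplus> \<sim> x)"
    using x a by (metis add_assoc neg_closed)
  then have "\<sim> a = \<one>\<^sub>M" using x a by (simp add: add_neg_self add_one closed)
  then show False using a neg_neg[of a] neg_one by simp
qed

end

section \<open>Ideals and the congruences they define\<close>

locale mv_algebra_ideal = mv_algebra +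
  fixes I
  assumes ideal: "mv_ideal A I"
begin

lemma ideal_carrier: "x \<in> I \<Longrightarrow> x \<in> carrier A"
  and zero_in_ideal: "\<zero> \<in> I"
  and ideal_add: "\<lbrakk>x \<in> I; y \<in> I\<rbrakk> \<Longrightarrow> x \<oplus> y \<in> I"
  and ideal_down: "\<lbrakk>y \<in> I; x \<in> carrier A; x \<preceq> y\<rbrakk> \<Longrightarrow> x \<in> I"
  using ideal unfolding mv_ideal_def by auto

lemma add_in_ideal_iff:
  assumes "x \<in> carrier A" "y \<in> carrier A"
  shows "x \<oplus> y \<in> I \<longleftrightarrow> x \<in> I \<and> y \<in> I"
  using assms ideal_add ideal_down le_add by (metis add_comm)

abbreviation congruent_mod (infix \<open>\<equiv>\<^sub>I\<close> 50)
  where "x \<equiv>\<^sub>I y \<equiv> (x, y) \<in> mv_cong A I"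

lemma cong_iff:
  "x \<equiv>\<^sub>I y \<longleftrightarrow>
    x \<in> carrier A \<and> y \<in> carrier A \<and> x \<odot> \<sim> y \<in> I \<and> y \<odot> \<sim> x \<in> I"
  by (auto simp: mv_cong_def mv_dist_def add_in_ideal_iff closed)

lemma cong_carrier: "x \<equiv>\<^sub>I y \<Longrightarrow> x \<in> carrier A \<and> y \<in> carrier A"
  by (simp add: cong_iff)

lemma cong_refl: "x \<in> carrier A \<Longrightarrow> x \<equiv>\<^sub>I x"
  by (simp add: cong_iff mult_neg_self zero_in_ideal)

lemma cong_sym: "x \<equiv>\<^sub>I y \<Longrightarrow> y \<equiv>\<^sub>I x"
  by (simp add: cong_iff)

text \<open>Serves twice: with \<open>z\<close> negated it gives transitivity of the congruence, and
  with \<open>x = 1\<close> it characterises the vertices of the graph.\<close>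

lemma ideal_cut:
  assumes "x \<in> carrier A" "y \<in> carrier A" "z \<in> carrier A" "x \<odot> \<sim> y \<in> I" "y \<odot> z \<in> I"
  shows "x \<odot> z \<in> I"
  using assms le_cut[of x y z] ideal_add ideal_down mult_closed by blast

lemma cong_trans: "\<lbrakk>x \<equiv>\<^sub>I y; y \<equiv>\<^sub>I z\<rbrakk> \<Longrightarrow> x \<equiv>\<^sub>I z"
  by (auto simp: cong_iff closed intro: ideal_cut[of _ y])

lemma equiv_cong: "equiv (carrier A) (mv_cong A I)"
  by (intro equivI refl_onI symI transI)
    (auto intro: cong_refl cong_sym cong_trans dest: cong_carrier)

lemma cong_neg: "x \<equiv>\<^sub>I y \<Longrightarrow> \<sim> x \<equiv>\<^sub>I \<sim> y"
  by (auto simp: cong_iff closed neg_neg mult_comm)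

lemma cong_mult_right: "\<lbrakk>x \<equiv>\<^sub>I y; w \<in> carrier A\<rbrakk> \<Longrightarrow> x \<odot> w \<equiv>\<^sub>I y \<odot> w"
  unfolding cong_iff by (metis mult_left_le_diff ideal_down neg_closed mult_closed)

lemma cong_mult:
  assumes "x \<equiv>\<^sub>I y" "x' \<equiv>\<^sub>I y'"
  shows "x \<odot> x' \<equiv>\<^sub>I y \<odot> y'"
  using assms cong_mult_right[of x y x'] cong_mult_right[of x' y' y]
  by (metis cong_trans cong_carrier mult_comm)

lemma cong_add: "\<lbrakk>x \<equiv>\<^sub>I y; x' \<equiv>\<^sub>I y'\<rbrakk> \<Longrightarrow> x \<oplus> x' \<equiv>\<^sub>I y \<oplus> y'"
  using cong_neg[OF cong_mult[OF cong_neg cong_neg], of x y x' y']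
  by (simp add: add_eq_neg_mult cong_carrier)

text \<open>The distance from \<open>x\<close> to 0 is \<open>x\<close> itself.\<close>

lemma cong_zero_iff: "x \<in> carrier A \<Longrightarrow> x \<equiv>\<^sub>I \<zero> \<longleftrightarrow> x \<in> I"
  by (simp add: mv_cong_def mv_dist_def closed mult_one add_zero mult_comm[of \<zero>]
      flip: mv_one_def)
    (simp add: mv_mult_def closed neg_neg add_one add_zero neg_one flip: mv_one_def)

lemma cong_ideal_iff: "x \<equiv>\<^sub>I y \<Longrightarrow> x \<in> I \<longleftrightarrow> y \<in> I"
  by (metis cong_zero_iff cong_sym cong_trans cong_carrier)

lemma cong_mult_ideal_iff:
  "\<lbrakk>x \<equiv>\<^sub>I y; z \<in> carrier A\<rbrakk> \<Longrightarrow> x \<odot> z \<in> I \<longleftrightarrow> y \<odot> z \<in> I"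
  using cong_ideal_iff cong_mult_right by blast

lemma cong_mult_ideal_iff':
  "\<lbrakk>x \<equiv>\<^sub>I y; z \<in> carrier A\<rbrakk> \<Longrightarrow> z \<odot> x \<in> I \<longleftrightarrow> z \<odot> y \<in> I"
  by (metis cong_mult_ideal_iff mult_comm cong_carrier)

text \<open>For a nonzero \<open>a\<close> in \<open>I\<close>, both \<open>x \<oplus> a\<close> and
  \<open>x \<odot> \<sim> a\<close> are congruent to \<open>x\<close>, and by
  \<open>add_or_diff_moves\<close> at least one of them differs from \<open>x\<close>.\<close>

lemma cong_class_nontrivial:
  assumes "x \<in> carrier A" "I \<noteq> {\<zero>}"
  obtains x' where "x' \<equiv>\<^sub>I x" "x' \<noteq> x"
proof -
  obtain a where a: "a \<in> I" "a \<noteq> \<zero>"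
    using assms(2) zero_in_ideal by auto
  have aA: "a \<in> carrier A" and a0: "a \<equiv>\<^sub>I \<zero>"
    using a by (auto simp: ideal_carrier cong_zero_iff)
  have "x \<oplus> a \<equiv>\<^sub>I x"
    using cong_add[OF cong_refl[OF assms(1)] a0] assms(1) by (simp add: add_zero)
  moreover have "x \<odot> \<sim> a \<equiv>\<^sub>I x"
    using cong_mult[OF cong_refl[OF assms(1)] cong_neg[OF a0]] assms(1)
    by (simp add: mult_one flip: mv_one_def)
  ultimately show ?thesis
    using that add_or_diff_moves[OF assms(1) aA a(2)] by blast
qed

end

section \<open>The graph of an ideal\<close>

lemma pair_wf_ideal_graph: "pair_wf_digraph (ideal_graph A I)"
  by unfold_locales (auto simp: ideal_graph_def Let_def)

lemmas ideal_graph_dist_iff =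
  pair_wf_digraph.graph_dist_le_0_iff[OF pair_wf_ideal_graph]
  pair_wf_digraph.graph_dist_le_1_iff[OF pair_wf_ideal_graph]
  pair_wf_digraph.graph_dist_le_2_iff[OF pair_wf_ideal_graph]

context mv_algebra_ideal
begin

abbreviation (input) "V \<equiv> {x \<in> carrier A. x \<notin> I \<and> \<sim> x \<notin> I}"

lemma neg_in_V: "x \<in> V \<Longrightarrow> \<sim> x \<in> V"
  by (auto simp: closed neg_neg)

text \<open>If \<open>x \<odot> y\<close> and \<open>\<sim> x\<close> both lay in \<open>I\<close>,
  cutting out \<open>x\<close> would put \<open>y\<close> in \<open>I\<close>. Conversely,
  \<open>\<sim> x\<close> is a partner of \<open>x\<close>, since their product is 0.\<close>

lemma zero_divisor_mod_iff:
  "x \<in> carrier A - I \<and> (\<exists>y \<in> carrier A - I. x \<odot> y \<in> I) \<longleftrightarrow> x \<in> V"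
proof
  assume L: "x \<in> carrier A - I \<and> (\<exists>y \<in> carrier A - I. x \<odot> y \<in> I)"
  then obtain y where xy: "x \<in> carrier A" "y \<in> carrier A" "x \<notin> I" "y \<notin> I" "x \<odot> y \<in> I"
    by auto
  have "\<one>\<^sub>M \<odot> \<sim> x \<notin> I"
    using ideal_cut[of "\<one>\<^sub>M" x y] xy by (auto simp: closed mult_comm[of "\<one>\<^sub>M"] mult_one)
  then show "x \<in> V"
    using xy by (simp add: closed mult_comm[of "\<one>\<^sub>M"] mult_one)
next
  assume "x \<in> V"
  then show "x \<in> carrier A - I \<and> (\<exists>y \<in> carrier A - I. x \<odot> y \<in> I)"
    using zero_in_ideal by (auto intro!: bexI[of _ "\<sim> x"] simp: mult_neg_self closed)
qed

lemma pverts_ideal_graph: "pverts (ideal_graph A I) = V"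
  using zero_divisor_mod_iff by (auto simp: ideal_graph_def Let_def)

lemma parcs_ideal_graph:
  "(x, y) \<in> parcs (ideal_graph A I) \<longleftrightarrow> x \<in> V \<and> y \<in> V \<and> x \<noteq> y \<and> x \<odot> y \<in> I"
  using pverts_ideal_graph by (simp add: ideal_graph_def Let_def)

lemma ideal_graph_diam_le_1_iff:
  "graph_diam (with_proj (ideal_graph A I)) \<le> 1 \<longleftrightarrow> (\<forall>x\<in>V. \<forall>y\<in>V. x = y \<or> x \<odot> y \<in> I)"
  unfolding graph_diam_le_iff with_proj_simps pverts_ideal_graph
  by (intro ball_cong refl) (auto simp: ideal_graph_dist_iff pverts_ideal_graph parcs_ideal_graph)

lemma ideal_graph_diam_le_2_iff:
  "graph_diam (with_proj (ideal_graph A I)) \<le> 2 \<longleftrightarrow>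
    (\<forall>x\<in>V. \<forall>y\<in>V. x = y \<or> x \<odot> y \<in> I \<or> (\<exists>w\<in>V. w \<noteq> x \<and> w \<noteq> y \<and> x \<odot> w \<in> I \<and> w \<odot> y \<in> I))"
  unfolding graph_diam_le_iff with_proj_simps pverts_ideal_graph
  by (intro ball_cong refl) (auto simp: ideal_graph_dist_iff pverts_ideal_graph parcs_ideal_graph)

section \<open>The quotient algebra and its zero-divisor graph, expressed through
  representatives\<close>

abbreviation (input) "cls x \<equiv> mv_cong A I `` {x}"
abbreviation (input) "Q \<equiv> mv_quotient A I"

lemma cls_eq_iff:
  "\<lbrakk>x \<in> carrier A; y \<in> carrier A\<rbrakk> \<Longrightarrow> cls x = cls y \<longleftrightarrow> x \<equiv>\<^sub>I y"
  using eq_equiv_class_iff[OF equiv_cong] .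

lemma carrier_quotient: "carrier Q = cls ` carrier A"
  by (auto simp: mv_quotient_def quotient_def)

lemma zero_quotient: "\<zero>\<^bsub>Q\<^esub> = cls \<zero>"
  by (simp add: mv_quotient_def)

lemma neg_quotient:
  assumes "x \<in> carrier A"
  shows "\<sim>\<^bsub>Q\<^esub> (cls x) = cls (\<sim> x)"
proof -
  have "(\<lambda>x. cls (\<sim> x)) respects mv_cong A I"
    by (intro congruentI equiv_class_eq[OF equiv_cong] cong_neg)
  from UN_equiv_class[OF equiv_cong this assms] show ?thesis
    by (simp add: mv_quotient_def)
qed

lemma add_quotient:
  assumes "x \<in> carrier A" "y \<in> carrier A"
  shows "cls x \<oplus>\<^bsub>Q\<^esub> cls y = cls (x \<oplus> y)"
proof -
  have "(\<lambda>x y. cls (x \<oplus> y)) respects2 mv_cong A I"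
    by (intro congruent2I' equiv_class_eq[OF equiv_cong] cong_add)
  from UN_equiv_class2[OF equiv_cong equiv_cong this assms] show ?thesis
    by (simp add: mv_quotient_def)
qed

lemma mult_quotient:
  "\<lbrakk>x \<in> carrier A; y \<in> carrier A\<rbrakk> \<Longrightarrow> cls x \<odot>\<^bsub>Q\<^esub> cls y = cls (x \<odot> y)"
  by (simp add: mv_mult_def neg_quotient add_quotient closed)

lemma cls_eq_zero_iff: "x \<in> carrier A \<Longrightarrow> cls x = \<zero>\<^bsub>Q\<^esub> \<longleftrightarrow> x \<in> I"
  by (simp add: zero_quotient cls_eq_iff cong_zero_iff closed)

text \<open>Moves the condition of having a partner through a map that need not be injective; with
  \<open>f\<close> the class map it carries the zero-divisor condition from \<open>Q\<close> to
  representatives.\<close>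

lemma Collect_image_bex:
  assumes "\<And>x y. \<lbrakk>x \<in> S; y \<in> S\<rbrakk> \<Longrightarrow> R (f x) (f y) \<longleftrightarrow> P x y"
  shows "{X \<in> f ` S. \<exists>Y \<in> f ` S. R X Y} = f ` {x \<in> S. \<exists>y \<in> S. P x y}"
  using assms by auto

lemma pverts_zero_divisor_graph: "pverts (zero_divisor_graph Q) = cls ` V"
proof -
  have "cls ` carrier A - {\<zero>\<^bsub>Q\<^esub>} = cls ` (carrier A - I)"
    using cls_eq_zero_iff by blast
  moreover have "cls x \<odot>\<^bsub>Q\<^esub> cls y \<in> {\<zero>\<^bsub>Q\<^esub>} \<longleftrightarrow> x \<odot> y \<in> I"
    if "x \<in> carrier A - I" "y \<in> carrier A - I" for x y
    using that cls_eq_zero_iff[of "x \<odot> y"] by (simp add: mult_quotient closed)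
  ultimately have "pverts (zero_divisor_graph Q) =
      cls ` {x \<in> carrier A - I. \<exists>y \<in> carrier A - I. x \<odot> y \<in> I}"
    unfolding zero_divisor_graph_def ideal_graph_def Let_def pair_pre_digraph.simps carrier_quotient
    by (simp only: Collect_image_bex)
  then show ?thesis using zero_divisor_mod_iff by simp
qed

lemma parcs_zero_divisor_graph:
  assumes "x \<in> V" "y \<in> V"
  shows "(cls x, cls y) \<in> parcs (zero_divisor_graph Q) \<longleftrightarrow> \<not> x \<equiv>\<^sub>I y \<and> x \<odot> y \<in> I"
proof -
  have "cls x \<in> pverts (zero_divisor_graph Q)" "cls y \<in> pverts (zero_divisor_graph Q)"
    using assms by (auto simp: pverts_zero_divisor_graph)
  then show ?thesis
    using assms
    by (simp add: zero_divisor_graph_def ideal_graph_def Let_def mult_quotient cls_eq_zero_iff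
        cls_eq_iff closed)
qed

text \<open>The case of an empty \<open>V\<close> is included: the supremum is then 0 and the right
  side is vacuous.\<close>

lemma zero_divisor_graph_diam_le_0_iff:
  "graph_diam (with_proj (zero_divisor_graph Q)) \<le> 0 \<longleftrightarrow> (\<forall>x\<in>V. \<forall>y\<in>V. x \<equiv>\<^sub>I y)"
proof -
  have "graph_diam (with_proj (zero_divisor_graph Q)) \<le> 0 \<longleftrightarrow>
      (\<forall>x\<in>V. \<forall>y\<in>V. graph_dist (with_proj (zero_divisor_graph Q)) (cls x) (cls y) \<le> 0)"
    unfolding graph_diam_le_iff by (simp only: with_proj_simps pverts_zero_divisor_graph ball_simps)
  also have "\<dots> \<longleftrightarrow> (\<forall>x\<in>V. \<forall>y\<in>V. cls x = cls y)"
    unfolding zero_divisor_graph_def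
    by (intro ball_cong refl ideal_graph_dist_iff(1))
      (simp only: pverts_zero_divisor_graph[unfolded zero_divisor_graph_def], erule imageI)
  also have "\<dots> \<longleftrightarrow> (\<forall>x\<in>V. \<forall>y\<in>V. x \<equiv>\<^sub>I y)"
    by (intro ball_cong refl) (simp add: cls_eq_iff)
  finally show ?thesis .
qed

lemma zero_divisor_graph_diam_le_2_iff:
  "graph_diam (with_proj (zero_divisor_graph Q)) \<le> 2 \<longleftrightarrow>
    (\<forall>x\<in>V. \<forall>y\<in>V. x \<equiv>\<^sub>I y \<or> x \<odot> y \<in> I \<or>
      (\<exists>w\<in>V. \<not> x \<equiv>\<^sub>I w \<and> \<not> w \<equiv>\<^sub>I y \<and> x \<odot> w \<in> I \<and> w \<odot> y \<in> I))"
proof -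
  let ?arc = "\<lambda>X Y. (X, Y) \<in> parcs (zero_divisor_graph Q)"
  \<comment> \<open>The middle vertex of a path in the quotient graph is a priori any set; as the
    head of an arc it must be the class of some element of \<open>V\<close>.\<close>
  have arc: "?arc X Y \<Longrightarrow> Y \<in> cls ` V" for X Y
    using pair_wf_digraph.in_arcsD2[OF pair_wf_ideal_graph, of X Y Q "{\<zero>\<^bsub>Q\<^esub>}"]
    by (simp only: pverts_zero_divisor_graph flip: zero_divisor_graph_def)
  have "graph_diam (with_proj (zero_divisor_graph Q)) \<le> 2 \<longleftrightarrow>
      (\<forall>x\<in>V. \<forall>y\<in>V. graph_dist (with_proj (zero_divisor_graph Q)) (cls x) (cls y) \<le> 2)"
    unfolding graph_diam_le_iff by (simp only: with_proj_simps pverts_zero_divisor_graph ball_simps)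
  also have "\<dots> \<longleftrightarrow> (\<forall>x\<in>V. \<forall>y\<in>V. cls x = cls y \<or> ?arc (cls x) (cls y) \<or>
      (\<exists>W. ?arc (cls x) W \<and> ?arc W (cls y)))"
    unfolding zero_divisor_graph_def
    by (intro ball_cong refl ideal_graph_dist_iff(3))
      (simp only: pverts_zero_divisor_graph[unfolded zero_divisor_graph_def], erule imageI)
  also have "\<dots> \<longleftrightarrow> (\<forall>x\<in>V. \<forall>y\<in>V. cls x = cls y \<or> ?arc (cls x) (cls y) \<or>
      (\<exists>w\<in>V. ?arc (cls x) (cls w) \<and> ?arc (cls w) (cls y)))"
    using arc by (intro ball_cong refl disj_cong) blast
  also have "\<dots> \<longleftrightarrow> (\<forall>x\<in>V. \<forall>y\<in>V. x \<equiv>\<^sub>I y \<or> x \<odot> y \<in> I \<or>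
      (\<exists>w\<in>V. \<not> x \<equiv>\<^sub>I w \<and> \<not> w \<equiv>\<^sub>I y \<and> x \<odot> w \<in> I \<and> w \<odot> y \<in> I))"
  proof (intro ball_cong refl)
    fix x y assume xy: "x \<in> V" "y \<in> V"
    then have cls_eq: "cls x = cls y \<longleftrightarrow> x \<equiv>\<^sub>I y" by (simp add: cls_eq_iff)
    have path: "(\<exists>w\<in>V. ?arc (cls x) (cls w) \<and> ?arc (cls w) (cls y)) \<longleftrightarrow>
        (\<exists>w\<in>V. \<not> x \<equiv>\<^sub>I w \<and> \<not> w \<equiv>\<^sub>I y \<and> x \<odot> w \<in> I \<and> w \<odot> y \<in> I)"
      using xy by (intro bex_cong refl) (simp only: parcs_zero_divisor_graph conj_ac)
    show "(cls x = cls y \<or> ?arc (cls x) (cls y) \<or>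
        (\<exists>w\<in>V. ?arc (cls x) (cls w) \<and> ?arc (cls w) (cls y))) \<longleftrightarrow>
      (x \<equiv>\<^sub>I y \<or> x \<odot> y \<in> I \<or>
        (\<exists>w\<in>V. \<not> x \<equiv>\<^sub>I w \<and> \<not> w \<equiv>\<^sub>I y \<and> x \<odot> w \<in> I \<and> w \<odot> y \<in> I))"
      \<comment> \<open>The conjunct \<open>\<not> x \<equiv>\<^sub>I y\<close> in the adjacency
        condition is absorbed by the first disjunct.\<close>
      unfolding cls_eq path parcs_zero_divisor_graph[OF xy] by argo
  qed
  finally show ?thesis .
qed

section \<open>Comparison of the two diameters\<close>

lemma diam_le_2_iff:
  "graph_diam (with_proj (ideal_graph A I)) \<le> 2 \<longleftrightarrow>
    graph_diam (with_proj (zero_divisor_graph Q)) \<le> 2"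
  unfolding ideal_graph_diam_le_2_iff zero_divisor_graph_diam_le_2_iff
proof (intro ball_cong refl)
  fix x y assume xy: "x \<in> V" "y \<in> V"
  then have carr: "x \<in> carrier A" "y \<in> carrier A" by auto
  show "(x = y \<or> x \<odot> y \<in> I \<or> (\<exists>w\<in>V. w \<noteq> x \<and> w \<noteq> y \<and> x \<odot> w \<in> I \<and> w \<odot> y \<in> I)) \<longleftrightarrow>
    (x \<equiv>\<^sub>I y \<or> x \<odot> y \<in> I \<or>
      (\<exists>w\<in>V. \<not> x \<equiv>\<^sub>I w \<and> \<not> w \<equiv>\<^sub>I y \<and> x \<odot> w \<in> I \<and> w \<odot> y \<in> I))"
    (is "?L \<longleftrightarrow> ?R")
  proof
    \<comment> \<open>If \<open>w\<close> were congruent to \<open>x\<close>, then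
      \<open>w \<odot> y\<close> in \<open>I\<close> would put \<open>x \<odot> y\<close> in
      \<open>I\<close>; if it were congruent to \<open>y\<close>, \<open>x \<odot> w\<close> would
      do the same.\<close>
    have "\<not> x \<equiv>\<^sub>I w" "\<not> w \<equiv>\<^sub>I y" if "x \<odot> w \<in> I" "w \<odot> y \<in> I" "x \<odot> y \<notin> I" for w
      using that carr cong_mult_ideal_iff[of x w y] cong_mult_ideal_iff'[of w y x] by auto
    moreover assume ?L
    ultimately show ?R using cong_refl[OF carr(1)] by blast
  next
    assume R: ?R
    show ?L
    proof (cases "x \<equiv>\<^sub>I y")
      case True
      have "x \<odot> \<sim> x \<in> I" using carr by (simp add: mult_neg_self zero_in_ideal)
      moreover from this have "\<sim> x \<odot> y \<in> I"
        using cong_mult_ideal_iff[OF True, of "\<sim> x"] carr by (simp add: closed mult_comm)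
      ultimately obtain w where "w \<in> V" "x \<odot> w \<in> I" "w \<odot> y \<in> I"
        using neg_in_V[OF xy(1)] by blast
      \<comment> \<open>The witness \<open>\<sim> x\<close> may coincide with an endpoint; then one
        of the two products is \<open>x \<odot> y\<close> itself, so the second disjunct
        holds.\<close>
      then show ?thesis by (cases "w = x \<or> w = y") auto
    next
      case False
      have "w \<noteq> x" "w \<noteq> y" if "\<not> x \<equiv>\<^sub>I w" "\<not> w \<equiv>\<^sub>I y" for w
        using that carr cong_refl by auto
      with R False show ?thesis by blast
    qed
  qed
qed

lemma diam_le_1_iff:
  assumes "I \<noteq> {\<zero>}"
  shows "graph_diam (with_proj (ideal_graph A I)) \<le> 1 \<longleftrightarrow>
    graph_diam (with_proj (zero_divisor_graph Q)) \<le> 0"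
  unfolding ideal_graph_diam_le_1_iff zero_divisor_graph_diam_le_0_iff
proof
  assume compl: "\<forall>x\<in>V. \<forall>y\<in>V. x = y \<or> x \<odot> y \<in> I"
  have mult: "x \<odot> y \<in> I" if "x \<in> V" "y \<in> V" for x y
  proof (cases "x = y")
    case True
    \<comment> \<open>Completeness says nothing about \<open>x \<odot> x\<close>, so one factor is
      replaced by a different member of the class of \<open>x\<close>.\<close>
    have "x \<in> carrier A" using that by simp
    then obtain x' where x': "x' \<equiv>\<^sub>I x" "x' \<noteq> x"
      using assms by (rule cong_class_nontrivial)
    then have "x' \<in> V"
      using that cong_ideal_iff[of x' x] cong_ideal_iff[OF cong_neg, of x' x] cong_carrier by auto
    then have "x' \<odot> x \<in> I" using compl x' that by blast
    then show ?thesis using True cong_mult_ideal_iff[OF x'(1), of x] that by simp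
  qed (use compl that in blast)
  show "\<forall>x\<in>V. \<forall>y\<in>V. x \<equiv>\<^sub>I y"
  proof (intro ballI)
    fix x y assume xy: "x \<in> V" "y \<in> V"
    then show "x \<equiv>\<^sub>I y"
      using mult[OF xy(1) neg_in_V[OF xy(2)]] mult[OF xy(2) neg_in_V[OF xy(1)]]
      by (simp add: cong_iff)
  qed
next
  assume cong: "\<forall>x\<in>V. \<forall>y\<in>V. x \<equiv>\<^sub>I y"
  have "x \<odot> y \<in> I" if "x \<in> V" "y \<in> V" for x y
  proof -
    \<comment> \<open>Since \<open>\<sim> x\<close> is a vertex too, \<open>x \<odot> y\<close> is
      congruent to \<open>x \<odot> \<sim> x = 0\<close>.\<close>
    have "y \<equiv>\<^sub>I \<sim> x" using cong neg_in_V that by blast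
    then show ?thesis
      using cong_mult_ideal_iff'[of y "\<sim> x" x] that by (simp add: mult_neg_self zero_in_ideal)
  qed
  then show "\<forall>x\<in>V. \<forall>y\<in>V. x = y \<or> x \<odot> y \<in> I" by blast
qed

end

text \<open>Together with \<open>enat_eq_1_or_2_iff\<close> this turns exact diameters into upper
  bounds, so that \<open>diam_le_2_iff\<close> and \<open>diam_le_1_iff\<close> match the two sides
  of the theorem conjunct by conjunct.\<close>

lemma enat_eq_2_iff: "n = (2 :: enat) \<longleftrightarrow> n \<le> 2 \<and> \<not> n \<le> 1"
  by (cases n) (auto simp: numeral_eq_enat one_enat_def)

lemma enat_eq_1_or_2_iff: "n = (1 :: enat) \<or> n = 2 \<longleftrightarrow> n \<le> 2 \<and> \<not> n \<le> 0"
  by (cases n) (auto simp: numeral_eq_enat one_enat_def zero_enat_def)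

theorem theorem4p15:
  fixes A :: "('a, 'm) mv_algebra_scheme" and I :: "'a set"
  assumes "mv_algebra A"
    and "mv_proper_ideal A I"
    and "I \<noteq> {mv_zero A}"
  shows "graph_diam (with_proj (ideal_graph A I)) = 2 \<longleftrightarrow>
    graph_diam (with_proj (zero_divisor_graph (mv_quotient A I))) = 1 \<or>
    graph_diam (with_proj (zero_divisor_graph (mv_quotient A I))) = 2"
proof -
  interpret mv_algebra_ideal A I
    using assms by (simp add: mv_algebra_ideal_def mv_algebra_ideal_axioms_def mv_proper_ideal_def)
  show ?thesis
    unfolding enat_eq_1_or_2_iff enat_eq_2_iff[of "graph_diam (with_proj (ideal_graph A I))"]
    using diam_le_2_iff diam_le_1_iff[OF assms(3)] by simp
qed

end
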